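(* Let $G$ be a small profinite group and let $\varphi : K \to G$ be a Frattini cover of $G$. Then $K$ is small.
   Context: A profinite group is called small if for each positive integer $n$ it has only finitely many open subgroups of index $n$. The Frattini subgroup $\Phi(K)$ of a profinite group $K$ is the intersection of all maximal open subgroups of $K$ (equal to $K$ if there are none). A Frattini cover of a profinite group $G$ is an epimorphism (i.e. a continuous surjective group homomorphism) $\varphi : K \to G$ from a profinite group $K$ to $G$ with $\ker(\varphi) \subseteq \Phi(K)$. *)

theory Defs
  imports "HOL-Analysis.Analysis" "HOL-Algebra.Coset"
begin

definition topological_group :: "('a, 'm) monoid_scheme \<Rightarrow> 'a topology \<Rightarrow> bool" where
  "topological_group G T \<longleftrightarrow>
     group G \<and> topspace T = carrier G \<and>
     continuous_map (prod_topology T T) T (\<lambda>(x, y). x \<otimes>\<^bsub>G\<^esub> y) \<and>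
     continuous_map T T (\<lambda>x. inv\<^bsub>G\<^esub> x)"

definition totally_disconnected_space :: "'a topology \<Rightarrow> bool" where
  "totally_disconnected_space T \<longleftrightarrow>
     (\<forall>x \<in> topspace T. connected_component_of_set T x = {x})"

definition profinite_group :: "('a, 'm) monoid_scheme \<Rightarrow> 'a topology \<Rightarrow> bool" where
  "profinite_group G T \<longleftrightarrow>
     topological_group G T \<and> compact_space T \<and> Hausdorff_space T \<and>
     totally_disconnected_space T"

definition open_subgroup :: "'a set \<Rightarrow> ('a, 'm) monoid_scheme \<Rightarrow> 'a topology \<Rightarrow> bool" where
  "open_subgroup H G T \<longleftrightarrow> subgroup H G \<and> openin T H"

text \<open>Since \<^const>\<open>card\<close> is 0 on infinite sets, the equation below expresses
  ``index \<open>n\<close>'' only because \<open>n\<close> is positive.\<close>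

definition small_profinite_group :: "('a, 'm) monoid_scheme \<Rightarrow> 'a topology \<Rightarrow> bool" where
  "small_profinite_group G T \<longleftrightarrow>
     profinite_group G T \<and>
     (\<forall>n::nat. n \<ge> 1 \<longrightarrow> finite {H. open_subgroup H G T \<and> card (rcosets\<^bsub>G\<^esub> H) = n})"

text \<open>Every subgroup containing an open subgroup is open, so it does not matter whether
  maximality is tested against all subgroups or only against the open ones.\<close>

definition maximal_open_subgroup :: "'a set \<Rightarrow> ('a, 'm) monoid_scheme \<Rightarrow> 'a topology \<Rightarrow> bool" where
  "maximal_open_subgroup M G T \<longleftrightarrow>
     open_subgroup M G T \<and> M \<noteq> carrier G \<and>
     (\<forall>H. subgroup H G \<longrightarrow> M \<subseteq> H \<longrightarrow> H = M \<or> H = carrier G)"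

text \<open>Intersecting with the carrier yields the whole group if there is no maximal open
  subgroup.\<close>

definition frattini_subgroup :: "('a, 'm) monoid_scheme \<Rightarrow> 'a topology \<Rightarrow> 'a set" where
  "frattini_subgroup G T = carrier G \<inter> \<Inter>{M. maximal_open_subgroup M G T}"

definition frattini_cover ::
  "('a, 'm) monoid_scheme \<Rightarrow> 'a topology \<Rightarrow> ('b, 'n) monoid_scheme \<Rightarrow> 'b topology
    \<Rightarrow> ('a \<Rightarrow> 'b) \<Rightarrow> bool" where
  "frattini_cover K TK G TG \<phi> \<longleftrightarrow>
     profinite_group K TK \<and> profinite_group G TG \<and>
     \<phi> \<in> epi K G \<and> continuous_map TK TG \<phi> \<and>
     kernel K G \<phi> \<subseteq> frattini_subgroup K TK"

end

theory Submission
  imports Defs "HOL-Algebra.Zassenhaus"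
begin

text \<open>
  Fix \<open>n\<close> and put \<open>r = n ^ n\<close>. The point is that the open subgroups of index \<open>n\<close> of a topological
  group are controlled by its maximal open subgroups of index at most \<open>r\<close>, and that a Frattini
  cover creates no new maximal open subgroups.

  A subgroup \<open>H\<close> of index \<open>n\<close> contains the kernel of the translation action on its cosets, a
  normal subgroup of index at most \<open>r\<close>. Let \<open>N\<close> be the intersection of these kernels for finitely
  many open \<open>H\<close> of index \<open>n\<close>. The index of \<open>N\<close> can grow with the number of the \<open>H\<close>, but a maximal
  subgroup \<open>P\<close> containing \<open>N\<close> still has index at most \<open>r\<close> (\<open>index_maximal_subgroup_le\<close>): some
  partial intersection \<open>V\<close> is not contained in \<open>P\<close> while its intersection with the next kernel is,
  so \<open>P V\<close> is the whole group and the index of \<open>P\<close> is at most that of this kernel.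

  Suppose only finitely many maximal open subgroups have index at most \<open>r\<close>, let \<open>D\<close> be their
  intersection and \<open>X\<close> a finite set of coset representatives of \<open>D\<close>. Then \<open>X\<close> and \<open>N\<close> generate
  the group, for otherwise they lie in a maximal subgroup \<open>P\<close>, which is one of those intersected
  in \<open>D\<close> and so contains the whole group. Hence each \<open>H\<close> is determined by the action of \<open>X\<close> on its
  cosets, which bounds the number of the \<open>H\<close> by \<open>(n ^ n) ^ card X\<close>
  (\<open>card_subgroups_of_index_le\<close>). The set \<open>X\<close> does not depend on the family of the \<open>H\<close>, so the
  bound holds for all finite families and there are finitely many \<open>H\<close> altogether
  (\<open>finite_open_subgroups_of_index\<close>).

  Finally let \<open>\<phi>\<close> be a Frattini cover of \<open>G\<close> with domain \<open>K\<close>. Every maximal open subgroup of \<open>K\<close>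
  contains the kernel of \<open>\<phi>\<close>, so it is the preimage of an open subgroup of \<open>G\<close> of the same index,
  and smallness of \<open>G\<close> leaves finitely many of index at most \<open>r\<close>
  (\<open>finite_maximal_open_subgroups_cover\<close>).
\<close>

section \<open>Subgroups of finite index\<close>

lemma (in group) r_coset_eq_iff:
  assumes "subgroup H G" "x \<in> carrier G" "y \<in> carrier G"
  shows "H #> x = H #> y \<longleftrightarrow> x \<otimes> inv y \<in> H"
proof -
  interpret subgroup H G by fact
  have "H #> x = H #> y \<longleftrightarrow> x \<in> H #> y"
    using assms by (metis repr_independence rcos_self)
  then show ?thesis using rcos_module[OF is_group, of y x] assms by simp
qed

text \<open>Index bounds are derived by labelling: elements with the same label lie in the same coset,
  so there are at most as many cosets as labels. Stating this with an arbitrary label function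
  avoids transversals and index formulas in all later estimates.\<close>

lemma (in group) index_le_card:
  assumes H: "subgroup H G" and "finite S" and f: "f \<in> carrier G \<rightarrow> S"
    and sep: "\<And>x y. \<lbrakk>x \<in> carrier G; y \<in> carrier G; f x = f y\<rbrakk> \<Longrightarrow> x \<otimes> inv y \<in> H"
  shows "finite (rcosets H)" and "card (rcosets H) \<le> card S"
proof -
  define r where "r s = (SOME x. x \<in> carrier G \<and> f x = s)" for s
  have "rcosets H \<subseteq> (\<lambda>s. H #> r s) ` S"
  proof
    fix c assume "c \<in> rcosets H"
    then obtain x where x: "x \<in> carrier G" "c = H #> x" by (auto simp: RCOSETS_def)
    have r: "r (f x) \<in> carrier G \<and> f (r (f x)) = f x"
      unfolding r_def by (rule someI[of _ x]) (use x in auto)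
    then have "H #> x = H #> r (f x)"
      using sep[OF x(1)] r x by (subst r_coset_eq_iff[OF H]) auto
    then show "c \<in> (\<lambda>s. H #> r s) ` S" using x f by auto
  qed
  then show "finite (rcosets H)" "card (rcosets H) \<le> card S"
    using \<open>finite S\<close> by (auto intro: finite_surj surj_card_le)
qed

lemma (in group) subgroup_Inter_carrier:
  assumes "\<And>H. H \<in> \<H> \<Longrightarrow> subgroup H G"
  shows "subgroup (carrier G \<inter> \<Inter>\<H>) G"
  using subgroups_Inter[of "insert (carrier G) \<H>"] assms subgroup_self by auto

text \<open>The label of an element is its tuple of cosets.\<close>

lemma (in group) finite_index_Inter:
  assumes "finite \<H>" and \<H>: "\<And>H. H \<in> \<H> \<Longrightarrow> subgroup H G \<and> finite (rcosets H)"
  shows "finite (rcosets (carrier G \<inter> \<Inter>\<H>))"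
proof -
  let ?f = "\<lambda>x. restrict (\<lambda>H. H #> x) \<H>"
  let ?S = "PiE \<H> (\<lambda>H. rcosets H)"
  have S: "finite ?S" using assms by (intro finite_PiE) auto
  have f: "?f \<in> carrier G \<rightarrow> ?S"
    using \<H> rcosetsI[OF subgroup.subset] by auto
  have sep: "x \<otimes> inv y \<in> carrier G \<inter> \<Inter>\<H>"
    if x: "x \<in> carrier G" and y: "y \<in> carrier G" and e: "?f x = ?f y" for x y
  proof -
    have "x \<otimes> inv y \<in> H" if H: "H \<in> \<H>" for H
    proof -
      have "H #> x = H #> y" using fun_cong[OF e, of H] H by simp
      then show ?thesis using r_coset_eq_iff[of H x y] \<H>[OF H] x y by simp
    qed
    then show ?thesis using x y by simp
  qed
  have sub: "subgroup (carrier G \<inter> \<Inter>\<H>) G" by (rule subgroup_Inter_carrier) (use \<H> in blast)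
  show ?thesis by (rule index_le_card(1)[OF sub S f], rule sep, assumption+)
qed

text \<open>A subgroup above \<open>N\<close> is a union of cosets of \<open>N\<close>, hence is encoded by a subset of the finite
  set of cosets.\<close>

lemma (in group) finite_subgroups_above:
  assumes N: "subgroup N G" "finite (rcosets N)"
  shows "finite {H. subgroup H G \<and> N \<subseteq> H}"
proof (rule inj_on_finite)
  let ?f = "\<lambda>H. (\<lambda>x. N #> x) ` H"
  have mem: "x \<in> H \<longleftrightarrow> N #> x \<in> ?f H"
    if H: "subgroup H G" "N \<subseteq> H" and x: "x \<in> carrier G" for x H
  proof
    assume "N #> x \<in> ?f H"
    then obtain y where y: "y \<in> H" "N #> x = N #> y" by blast
    then have "x \<in> N #> y" using rcos_self[OF x N(1)] by simp
    then show "x \<in> H" using y H by (auto simp: r_coset_def intro: subgroup.m_closed)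
  qed blast
  show "inj_on ?f {H. subgroup H G \<and> N \<subseteq> H}"
  proof (rule inj_onI)
    fix H H' assume a: "H \<in> {H. subgroup H G \<and> N \<subseteq> H}" "H' \<in> {H. subgroup H G \<and> N \<subseteq> H}"
      and e: "?f H = ?f H'"
    have "x \<in> H \<longleftrightarrow> x \<in> H'" if "x \<in> carrier G" for x
      using mem[of H x] mem[of H' x] a that e by simp
    then show "H = H'" using a subgroup.subset[of H G] subgroup.subset[of H' G] by blast
  qed
  show "?f ` {H. subgroup H G \<and> N \<subseteq> H} \<subseteq> Pow (rcosets N)"
    using rcosetsI[OF subgroup.subset[OF N(1)]] subgroup.subset by blast
  show "finite (Pow (rcosets N))" using N(2) by simp
qed

lemma (in group) maximal_subgroup_above:
  assumes N: "subgroup N G" "finite (rcosets N)"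
    and L: "subgroup L G" "N \<subseteq> L" "L \<noteq> carrier G"
  obtains P where "subgroup P G" "L \<subseteq> P" "P \<noteq> carrier G"
    "\<And>H. \<lbrakk>subgroup H G; P \<subseteq> H\<rbrakk> \<Longrightarrow> H = P \<or> H = carrier G"
proof -
  let ?A = "{H. subgroup H G \<and> L \<subseteq> H \<and> H \<noteq> carrier G}"
  have "finite ?A"
    by (rule finite_subset[OF _ finite_subgroups_above[OF N]]) (use L(2) in blast)
  moreover have "?A \<noteq> {}" using L by auto
  ultimately have "\<exists>P \<in> ?A. \<forall>H \<in> ?A. P \<subseteq> H \<longrightarrow> P = H" by (rule finite_has_maximal)
  then obtain P where P: "P \<in> ?A" and max: "\<forall>H \<in> ?A. P \<subseteq> H \<longrightarrow> P = H" by (elim bexE)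
  show ?thesis
  proof (rule that[of P])
    fix H assume H: "subgroup H G" "P \<subseteq> H"
    show "H = P \<or> H = carrier G"
    proof (cases "H = carrier G")
      case False
      then have "H \<in> ?A" using H P by auto
      then show ?thesis using max H(2) by auto
    qed simp
  qed (use P in auto)
qed

section \<open>Maximal subgroups above an intersection of normal subgroups\<close>

lemma (in group) normal_Inter_finite:
  assumes "finite \<N>" "\<And>N. N \<in> \<N> \<Longrightarrow> N \<lhd> G"
  shows "carrier G \<inter> \<Inter>\<N> \<lhd> G"
  using assms
proof (induction \<N> rule: finite_induct)
  case empty
  have "carrier G \<lhd> G" by (rule normal_invI) (auto simp: subgroup_self)
  then show ?case by simp
next
  case (insert N \<N>)
  then have "N \<inter> (carrier G \<inter> \<Inter>\<N>) \<lhd> G"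
    by (simp add: normal_subgroup_intersect[of N "carrier G \<inter> \<Inter>\<N>"])
  then show ?case by (simp add: Int_left_commute)
qed

text \<open>The bound does not depend on the number of normal subgroups. Inductively, let \<open>V\<close> be the
  intersection of the others. If \<open>V \<subseteq> P\<close>, the induction hypothesis applies. Otherwise \<open>P V\<close> is a
  subgroup strictly above \<open>P\<close>, hence everything, and
  \<open>[G : P] = [V : V \<inter> P] \<le> [V : V \<inter> N] \<le> [G : N]\<close>.\<close>

lemma (in group) index_maximal_subgroup_le:
  assumes P: "subgroup P G" "P \<noteq> carrier G"
    and max: "\<And>H. \<lbrakk>subgroup H G; P \<subseteq> H\<rbrakk> \<Longrightarrow> H = P \<or> H = carrier G"
    and "finite \<N>"
    and "\<And>N. N \<in> \<N> \<Longrightarrow> N \<lhd> G \<and> finite (rcosets N) \<and> card (rcosets N) \<le> r"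
    and "carrier G \<inter> \<Inter>\<N> \<subseteq> P"
  shows "finite (rcosets P) \<and> card (rcosets P) \<le> r"
  using assms(4-)
proof (induction \<N> rule: finite_induct)
  case empty
  then show ?case using P subgroup.subset by fastforce
next
  case (insert N \<N>)
  define V where "V = carrier G \<inter> \<Inter>\<N>"
  have V: "V \<lhd> G" unfolding V_def by (rule normal_Inter_finite) (use insert in auto)
  have N: "subgroup N G" "finite (rcosets N)" "card (rcosets N) \<le> r"
    using insert.prems(1)[of N] by (auto simp: normal_imp_subgroup)
  have NV: "N \<inter> V \<subseteq> P" using insert.prems(2) by (auto simp: V_def)
  show ?case
  proof (cases "V \<subseteq> P")
    case True
    then show ?thesis using insert by (auto simp: V_def)
  next
    case False
    have Vs: "subgroup V G" using V by (rule normal_imp_subgroup)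
    have PV: "subgroup (P <#> V) G"
      using mult_norm_subgroup[OF V P(1)] commut_normal[OF P(1) V] by simp
    have "p \<in> P <#> V" if "p \<in> P" for p
    proof -
      have "p = p \<otimes> \<one>" using that P(1) by (simp add: subgroup.mem_carrier)
      then show ?thesis using that Vs subgroup.one_closed unfolding set_mult_def by blast
    qed
    moreover have "v \<in> P <#> V" if "v \<in> V" for v
    proof -
      have "v = \<one> \<otimes> v" using that Vs by (simp add: subgroup.mem_carrier)
      then show ?thesis using that P(1) subgroup.one_closed unfolding set_mult_def by blast
    qed
    ultimately have eq: "P <#> V = carrier G" using max[OF PV] False by blast
    \<comment> \<open>Label an element by the coset modulo \<open>N\<close> of its component in \<open>V\<close>.\<close>
    have "\<forall>x \<in> carrier G. \<exists>v \<in> V. x \<otimes> inv v \<in> P"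
    proof
      fix x assume x: "x \<in> carrier G"
      then have "x \<in> P <#> V" using eq by simp
      then obtain p v where pv: "p \<in> P" "v \<in> V" "x = p \<otimes> v" unfolding set_mult_def by blast
      then have "p \<in> carrier G" "v \<in> carrier G" using P(1) Vs subgroup.mem_carrier by metis+
      then have "x \<otimes> inv v = p" using pv by (simp add: m_assoc)
      then show "\<exists>v \<in> V. x \<otimes> inv v \<in> P" using pv by metis
    qed
    then obtain v where v: "\<And>x. x \<in> carrier G \<Longrightarrow> v x \<in> V \<and> x \<otimes> inv (v x) \<in> P"
      unfolding Bex_def using bchoice[of "carrier G"] by meson
    have vc: "v x \<in> carrier G" if "x \<in> carrier G" for x using v[OF that] Vs subgroup.mem_carrier by metis
    have sep: "x \<otimes> inv y \<in> P"
      if x: "x \<in> carrier G" and y: "y \<in> carrier G" and e: "N #> v x = N #> v y" for x y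
    proof -
      have "v x \<otimes> inv (v y) \<in> N" using e r_coset_eq_iff[OF N(1)] vc x y by auto
      moreover have "v x \<otimes> inv (v y) \<in> V" using v x y Vs by (simp add: subgroup.m_closed subgroup.m_inv_closed)
      ultimately have "v x \<otimes> inv (v y) \<in> P" using NV by auto
      moreover have "x \<otimes> inv (v x) \<in> P" "inv (y \<otimes> inv (v y)) \<in> P"
        using v x y P(1) by (auto simp: subgroup.m_inv_closed)
      ultimately have "(x \<otimes> inv (v x)) \<otimes> (v x \<otimes> inv (v y)) \<otimes> inv (y \<otimes> inv (v y)) \<in> P"
        using P(1) by (simp add: subgroup.m_closed)
      moreover have "(x \<otimes> inv (v x)) \<otimes> (v x \<otimes> inv (v y)) \<otimes> inv (y \<otimes> inv (v y)) = x \<otimes> inv y"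
      proof -
        have cancel: "inv z \<otimes> (z \<otimes> w) = w" if "z \<in> carrier G" "w \<in> carrier G" for z w
          using that by (simp flip: m_assoc)
        show ?thesis using x y vc[OF x] vc[OF y] by (simp add: inv_mult_group m_assoc cancel)
      qed
      ultimately show ?thesis by simp
    qed
    have "(\<lambda>x. N #> v x) \<in> carrier G \<rightarrow> rcosets N"
      using vc rcosetsI[OF subgroup.subset[OF N(1)]] by blast
    note index = index_le_card[OF P(1) N(2) this]
    have "finite (rcosets P)" by (rule index(1), rule sep, assumption+)
    moreover have "card (rcosets P) \<le> card (rcosets N)" by (rule index(2), rule sep, assumption+)
    ultimately show ?thesis using N(3) by simp
  qed
qed



section \<open>The action on the cosets of a subgroup\<close>

text \<open>This is the normal core of \<open>H\<close>, the intersection of its conjugates. Describing it as the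
  kernel of right translation on the cosets makes the index bound and the openness immediate.\<close>

definition translation_kernel :: "('a, 'm) monoid_scheme \<Rightarrow> 'a set \<Rightarrow> 'a set" where
  "translation_kernel G H = {k \<in> carrier G. \<forall>c \<in> rcosets\<^bsub>G\<^esub> H. c #>\<^bsub>G\<^esub> k = c}"

lemma (in group) rcoset_translate:
  assumes "subgroup H G" "c \<in> rcosets H" "x \<in> carrier G"
  shows "c #> x \<in> rcosets H" "c #> x #> inv x = c" "c #> inv x #> x = c"
proof -
  obtain a where a: "a \<in> carrier G" "c = H #> a" using assms by (auto simp: RCOSETS_def)
  have H: "H \<subseteq> carrier G" using assms(1) by (rule subgroup.subset)
  have c: "c \<subseteq> carrier G" using a H by (simp add: r_coset_subset_G)
  show "c #> x \<in> rcosets H"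
    using a H assms(3) by (simp add: coset_mult_assoc rcosetsI)
  show "c #> x #> inv x = c" "c #> inv x #> x = c"
    using c assms(3) by (simp_all add: coset_mult_assoc)
qed

lemma (in group) rcoset_assoc:
  assumes "subgroup H G" "c \<in> rcosets H" "x \<in> carrier G" "y \<in> carrier G"
  shows "c #> x #> y = c #> (x \<otimes> y)"
proof -
  have "c \<subseteq> carrier G" using assms(1,2) subgroup.rcosets_carrier[OF _ is_group] by blast
  then show ?thesis using assms by (simp add: coset_mult_assoc)
qed

lemma (in group) translation_kernel_normal:
  assumes H: "subgroup H G"
  shows "translation_kernel G H \<lhd> G"
proof (rule normal_invI)
  show "subgroup (translation_kernel G H) G"
  proof (rule subgroupI)
    show "translation_kernel G H \<subseteq> carrier G" by (auto simp: translation_kernel_def)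
    have "\<one> \<in> translation_kernel G H"
      using subgroup.rcosets_carrier[OF H is_group] by (auto simp: translation_kernel_def)
    then show "translation_kernel G H \<noteq> {}" by blast
  next
    fix k assume k: "k \<in> translation_kernel G H"
    then show "inv k \<in> translation_kernel G H"
      using rcoset_translate(2)[OF H] by (force simp: translation_kernel_def)
  next
    fix k l assume "k \<in> translation_kernel G H" "l \<in> translation_kernel G H"
    then show "k \<otimes> l \<in> translation_kernel G H"
      by (auto simp: translation_kernel_def simp flip: rcoset_assoc[OF H])
  qed
next
  fix x k assume x: "x \<in> carrier G" and k: "k \<in> translation_kernel G H"
  have "c #> (x \<otimes> k \<otimes> inv x) = c" if c: "c \<in> rcosets H" for c
  proof -
    have kc: "k \<in> carrier G" using k by (simp add: translation_kernel_def)
    have "c #> (x \<otimes> k \<otimes> inv x) = c #> x #> k #> inv x"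
      using c x kc rcoset_translate(1)[OF H] by (simp add: rcoset_assoc[OF H])
    also have "c #> x #> k = c #> x"
      using k rcoset_translate(1)[OF H c x] by (simp add: translation_kernel_def)
    finally show ?thesis using rcoset_translate(2)[OF H c x] by simp
  qed
  then show "x \<otimes> k \<otimes> inv x \<in> translation_kernel G H"
    using x k by (auto simp: translation_kernel_def)
qed

text \<open>The label of an element is the map that it induces on the cosets of \<open>H\<close>. Counting all maps
  instead of the permutations gives the power instead of a factorial.\<close>

lemma (in group) index_translation_kernel_le:
  assumes H: "subgroup H G" and fin: "finite (rcosets H)"
  shows "finite (rcosets (translation_kernel G H))"
    and "card (rcosets (translation_kernel G H)) \<le> card (rcosets H) ^ card (rcosets H)"
proof -
  let ?f = "\<lambda>x. restrict (\<lambda>c. c #> x) (rcosets H)"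
  let ?S = "rcosets H \<rightarrow>\<^sub>E rcosets H"
  have S: "finite ?S" "card ?S = card (rcosets H) ^ card (rcosets H)"
    using fin by (auto intro: finite_PiE simp: card_funcsetE)
  have f: "?f \<in> carrier G \<rightarrow> ?S" using rcoset_translate(1)[OF H] by auto
  have sep: "x \<otimes> inv y \<in> translation_kernel G H"
    if x: "x \<in> carrier G" and y: "y \<in> carrier G" and e: "?f x = ?f y" for x y
  proof -
    have "c #> (x \<otimes> inv y) = c" if c: "c \<in> rcosets H" for c
    proof -
      have "c #> x = c #> y" using fun_cong[OF e, of c] c by simp
      then show ?thesis
        using rcoset_translate(2)[OF H c y] rcoset_assoc[OF H c x, of "inv y"] y by simp
    qed
    then show ?thesis using x y by (simp add: translation_kernel_def)
  qed
  have T: "subgroup (translation_kernel G H) G"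
    using translation_kernel_normal[OF H] by (rule normal_imp_subgroup)
  show "finite (rcosets (translation_kernel G H))"
    "card (rcosets (translation_kernel G H)) \<le> card (rcosets H) ^ card (rcosets H)"
    unfolding S(2)[symmetric] by (rule index_le_card[OF T S(1) f], rule sep, assumption+)+
qed

section \<open>Counting subgroups of a given index\<close>

text \<open>The elements whose translations commute with \<open>\<beta>\<close> form a subgroup, which contains \<open>X\<close> by
  assumption and \<open>N\<close> because \<open>N\<close> acts trivially on both sides. So \<open>\<beta>\<close> is an isomorphism of the
  whole action onto its image, and it carries the stabilizer \<open>H\<close> of the point \<open>H\<close> to the
  stabilizer \<open>H'\<close> of the point \<open>H'\<close>.\<close>

lemma (in group) subgroup_eq_if_same_translations:
  assumes H: "subgroup H G" and H': "subgroup H' G"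
    and gen: "\<And>L. \<lbrakk>subgroup L G; X \<subseteq> L; N \<subseteq> L\<rbrakk> \<Longrightarrow> L = carrier G"
    and X: "X \<subseteq> carrier G"
    and N: "N \<subseteq> translation_kernel G H" "N \<subseteq> translation_kernel G H'"
    and \<beta>: "\<beta> \<in> rcosets H \<rightarrow> rcosets H'" "inj_on \<beta> (rcosets H)" "\<beta> H = H'"
    and eqv: "\<And>c x. \<lbrakk>c \<in> rcosets H; x \<in> X\<rbrakk> \<Longrightarrow> \<beta> (c #> x) = \<beta> c #> x"
  shows "H = H'"
proof -
  define L where "L = {k \<in> carrier G. \<forall>c \<in> rcosets H. \<beta> (c #> k) = \<beta> c #> k}"
  have sub: "subgroup L G"
  proof (rule subgroupI)
    show "L \<subseteq> carrier G" by (auto simp: L_def)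
    have "\<beta> (c #> \<one>) = \<beta> c #> \<one>" if c: "c \<in> rcosets H" for c
    proof -
      have "c \<subseteq> carrier G" "\<beta> c \<subseteq> carrier G"
        using c \<beta>(1) subgroup.rcosets_carrier[OF H is_group] subgroup.rcosets_carrier[OF H' is_group] by blast+
      then show ?thesis by simp
    qed
    then have "\<one> \<in> L" by (auto simp: L_def)
    then show "L \<noteq> {}" by blast
  next
    fix k assume k: "k \<in> L"
    have "\<beta> (c #> inv k) = \<beta> c #> inv k" if c: "c \<in> rcosets H" for c
    proof -
      have kc: "k \<in> carrier G" using k by (simp add: L_def)
      have d: "c #> inv k \<in> rcosets H" using rcoset_translate(1)[OF H c] kc by simp
      have "\<beta> c = \<beta> (c #> inv k) #> k"
        using k d rcoset_translate(3)[OF H c kc] by (auto simp: L_def)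
      moreover have "\<beta> (c #> inv k) \<in> rcosets H'" using d \<beta>(1) by blast
      ultimately show ?thesis using rcoset_translate(2)[OF H' _ kc] by simp
    qed
    then show "inv k \<in> L" using k by (auto simp: L_def)
  next
    fix k l assume k: "k \<in> L" and l: "l \<in> L"
    have "\<beta> (c #> (k \<otimes> l)) = \<beta> c #> (k \<otimes> l)" if c: "c \<in> rcosets H" for c
    proof -
      have kl: "k \<in> carrier G" "l \<in> carrier G" using k l by (auto simp: L_def)
      have "\<beta> c \<in> rcosets H'" using c \<beta>(1) by blast
      then show ?thesis
        using k l c kl rcoset_translate(1)[OF H c kl(1)]
        by (simp add: L_def flip: rcoset_assoc[OF H] rcoset_assoc[OF H'])
    qed
    then show "k \<otimes> l \<in> L" using k l by (auto simp: L_def)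
  qed
  have "X \<subseteq> L" using X eqv by (auto simp: L_def)
  moreover have "N \<subseteq> L"
    using N \<beta>(1) by (fastforce simp: L_def translation_kernel_def)
  ultimately have L: "L = carrier G" using gen sub by blast
  have HR: "H \<in> rcosets H" using subgroup.subgroup_in_rcosets[OF H is_group] .
  have "k \<in> H \<longleftrightarrow> k \<in> H'" if k: "k \<in> carrier G" for k
  proof -
    have "k \<in> H \<longleftrightarrow> H #> k = H" using coset_join1[of H k] coset_join2[of k H] H k by blast
    also have "\<dots> \<longleftrightarrow> \<beta> (H #> k) = \<beta> H"
      using inj_on_eq_iff[OF \<beta>(2) rcoset_translate(1)[OF H HR k] HR] by simp
    also have "\<dots> \<longleftrightarrow> H' #> k = H'" using L k HR \<beta>(3) by (auto simp: L_def)
    also have "\<dots> \<longleftrightarrow> k \<in> H'" using coset_join1[of H' k] coset_join2[of k H'] H' k by blast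
    finally show ?thesis .
  qed
  then show ?thesis using subgroup.subset[OF H] subgroup.subset[OF H'] by blast
qed

lemma bij_betw_zero_index:
  assumes "finite A" "a \<in> A"
  shows "\<exists>b. bij_betw b A {..<card A} \<and> b a = 0"
proof -
  obtain h where h: "bij_betw h A {..<card A}"
    using ex_bij_betw_finite_nat[OF assms(1)] unfolding atLeast0LessThan by blast
  have "h a \<in> {..<card A}" using h assms(2) by (rule bij_betw_apply)
  moreover from this have "0 \<in> {..<card A}" by simp
  ultimately have "Transposition.transpose (h a) 0 permutes {..<card A}" by (rule permutes_swap_id)
  then have "bij_betw (Transposition.transpose (h a) 0 \<circ> h) A {..<card A}"
    using bij_betw_trans[OF h permutes_imp_bij] by blast
  then show ?thesis by (intro exI[of _ "Transposition.transpose (h a) 0 \<circ> h"]) simp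
qed

text \<open>Number the cosets of each \<open>H\<close> by \<open>{..<n}\<close>, with \<open>H\<close> itself numbered 0. Then each element of
  \<open>X\<close> becomes a map on \<open>{..<n}\<close>. If two subgroups give the same maps, matching equal numbers is an
  \<open>X\<close>-equivariant bijection between their cosets that respects the base points, so they agree.\<close>

lemma (in group) card_subgroups_of_index_le:
  assumes X: "finite X" "X \<subseteq> carrier G"
    and gen: "\<And>L. \<lbrakk>subgroup L G; X \<subseteq> L; N \<subseteq> L\<rbrakk> \<Longrightarrow> L = carrier G"
    and \<H>: "\<And>H. H \<in> \<H> \<Longrightarrow> subgroup H G \<and> finite (rcosets H) \<and> card (rcosets H) = n
                \<and> N \<subseteq> translation_kernel G H"
  shows "card \<H> \<le> (n ^ n) ^ card X"
proof -
  have "\<forall>H \<in> \<H>. \<exists>b. bij_betw b (rcosets H) {..<n} \<and> b H = 0"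
  proof
    fix H assume "H \<in> \<H>"
    then have "finite (rcosets H)" "H \<in> rcosets H" "card (rcosets H) = n"
      using \<H> subgroup.subgroup_in_rcosets[OF _ is_group] by auto
    then show "\<exists>b. bij_betw b (rcosets H) {..<n} \<and> b H = 0"
      using bij_betw_zero_index[of "rcosets H" H] by simp
  qed
  then obtain b where b: "\<And>H. H \<in> \<H> \<Longrightarrow> bij_betw (b H) (rcosets H) {..<n} \<and> b H H = 0" by metis
  define u where "u H = inv_into (rcosets H) (b H)" for H
  have u: "u H i \<in> rcosets H" "b H (u H i) = i" if "H \<in> \<H>" "i < n" for H i
    using b[OF that(1)] that(2) unfolding u_def bij_betw_def
    by (auto intro: inv_into_into f_inv_into_f)
  have ub: "u H (b H c) = c" "b H c < n" if "H \<in> \<H>" "c \<in> rcosets H" for H c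
    using b[OF that(1)] that(2) unfolding u_def bij_betw_def by auto
  define \<tau> where "\<tau> H = (\<lambda>x \<in> X. \<lambda>i \<in> {..<n}. b H (u H i #> x))" for H
  let ?T = "X \<rightarrow>\<^sub>E ({..<n} \<rightarrow>\<^sub>E {..<n})"
  have "\<tau> ` \<H> \<subseteq> ?T"
  proof clarify
    fix H assume H: "H \<in> \<H>"
    have "b H (u H i #> x) < n" if "x \<in> X" "i < n" for x i
      using ub(2)[OF H rcoset_translate(1)[of H "u H i" x]] \<H>[OF H] u[OF H that(2)] X(2) that(1) by blast
    then show "\<tau> H \<in> ?T" by (auto simp: \<tau>_def)
  qed
  moreover have "inj_on \<tau> \<H>"
  proof (rule inj_onI)
    fix H H' assume H: "H \<in> \<H>" and H': "H' \<in> \<H>" and e: "\<tau> H = \<tau> H'"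
    have s: "subgroup H G" "subgroup H' G" using \<H> H H' by auto
    let ?\<beta> = "\<lambda>c. u H' (b H c)"
    show "H = H'"
    proof (rule subgroup_eq_if_same_translations[where X = X and N = N and \<beta> = ?\<beta>])
      show "?\<beta> \<in> rcosets H \<rightarrow> rcosets H'" using u[OF H'] ub[OF H] by auto
      show "inj_on ?\<beta> (rcosets H)"
        by (rule inj_on_inverseI[where g = "\<lambda>c. u H (b H' c)"]) (use u[OF H'] ub[OF H] in auto)
      have "H' \<in> rcosets H'" using subgroup.subgroup_in_rcosets[OF s(2) is_group] .
      then show "?\<beta> H = H'" using ub(1)[OF H'] b[OF H] b[OF H'] by metis
    next
      fix c x assume c: "c \<in> rcosets H" and x: "x \<in> X"
      have xc: "x \<in> carrier G" using x X(2) by auto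
      have i: "b H c < n" using ub(2)[OF H c] .
      have "\<tau> H x (b H c) = \<tau> H' x (b H c)" using e by simp
      then have "b H (c #> x) = b H' (?\<beta> c #> x)"
        using x i ub(1)[OF H c] by (simp add: \<tau>_def)
      then show "?\<beta> (c #> x) = ?\<beta> c #> x"
        using ub(1)[OF H' rcoset_translate(1)[OF s(2) u(1)[OF H' i] xc]] by simp
    qed (use s gen X \<H>[OF H] \<H>[OF H'] in auto)
  qed
  moreover have "finite ?T" using X(1) by (intro finite_PiE) auto
  ultimately have "card \<H> \<le> card ?T" by (metis card_inj_on_le)
  also have "card ?T = (n ^ n) ^ card X" using X(1) by (simp add: card_funcsetE)
  finally show ?thesis .
qed


section \<open>Open subgroups of a topological group\<close>

lemma continuous_map_two_sided_translation:
  assumes "topological_group G T" "a \<in> carrier G" "b \<in> carrier G"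
  shows "continuous_map T T (\<lambda>x. a \<otimes>\<^bsub>G\<^esub> x \<otimes>\<^bsub>G\<^esub> b)"
proof -
  have T: "topspace T = carrier G"
    and m: "continuous_map (prod_topology T T) T (\<lambda>(x, y). x \<otimes>\<^bsub>G\<^esub> y)"
    using assms(1) by (auto simp: topological_group_def)
  have 1: "continuous_map T T (\<lambda>x. a \<otimes>\<^bsub>G\<^esub> x)"
    using continuous_map_compose[OF continuous_map_pairedI[OF continuous_map_const[THEN iffD2] continuous_map_id[unfolded id_def]] m] assms T
    by (simp add: o_def)
  show ?thesis
    using continuous_map_compose[OF continuous_map_pairedI[OF 1 continuous_map_const[THEN iffD2]] m] assms T
    by (simp add: o_def)
qed

lemma openin_subgroup_above:
  assumes tg: "topological_group G T" and N: "open_subgroup N G T" and H: "subgroup H G" "N \<subseteq> H"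
  shows "openin T H"
proof -
  interpret group G using tg by (simp add: topological_group_def)
  have T: "topspace T = carrier G" using tg by (simp add: topological_group_def)
  have Ns: "subgroup N G" "openin T N" using N by (auto simp: open_subgroup_def)
  have "\<exists>U. openin T U \<and> h \<in> U \<and> U \<subseteq> H" if h: "h \<in> H" for h
  proof (intro exI conjI)
    have hc: "h \<in> carrier G" using h H(1) by (simp add: subgroup.mem_carrier)
    let ?U = "{x \<in> topspace T. \<one>\<^bsub>G\<^esub> \<otimes>\<^bsub>G\<^esub> x \<otimes>\<^bsub>G\<^esub> inv\<^bsub>G\<^esub> h \<in> N}"
    show "openin T ?U"
      by (rule openin_continuous_map_preimage[OF continuous_map_two_sided_translation[OF tg] Ns(2)]) (use hc in auto)
    show "h \<in> ?U" using hc T Ns(1) by (simp add: subgroup.one_closed)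
    show "?U \<subseteq> H"
    proof
      fix x assume "x \<in> ?U"
      then have x: "x \<in> carrier G" "x \<otimes>\<^bsub>G\<^esub> inv\<^bsub>G\<^esub> h \<in> H" using T H(2) by auto
      then have "x \<otimes>\<^bsub>G\<^esub> inv\<^bsub>G\<^esub> h \<otimes>\<^bsub>G\<^esub> h \<in> H" using H(1) h by (simp add: subgroup.m_closed)
      then show "x \<in> H" using x hc by (simp add: m_assoc)
    qed
  qed
  then show ?thesis by (subst openin_subopen) blast
qed

lemma openin_translation_kernel:
  assumes tg: "topological_group G T" and H: "open_subgroup H G T" and fin: "finite (rcosets\<^bsub>G\<^esub> H)"
  shows "openin T (translation_kernel G H)"
proof -
  interpret group G using tg by (simp add: topological_group_def)
  have T: "topspace T = carrier G" using tg by (simp add: topological_group_def)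
  have Hs: "subgroup H G" "openin T H" using H by (auto simp: open_subgroup_def)
  let ?U = "\<lambda>c. {k \<in> carrier G. c #>\<^bsub>G\<^esub> k = c}"
  have "openin T (?U c)" if c: "c \<in> rcosets\<^bsub>G\<^esub> H" for c
  proof -
    obtain a where a: "a \<in> carrier G" "c = H #>\<^bsub>G\<^esub> a" using c by (auto simp: RCOSETS_def)
    have "?U c = {k \<in> topspace T. a \<otimes>\<^bsub>G\<^esub> k \<otimes>\<^bsub>G\<^esub> inv\<^bsub>G\<^esub> a \<in> H}"
    proof (intro Collect_cong conj_cong, goal_cases)
      case (2 k)
      then have "c #>\<^bsub>G\<^esub> k = H #>\<^bsub>G\<^esub> (a \<otimes>\<^bsub>G\<^esub> k)"
        using a T subgroup.subset[OF Hs(1)] by (simp add: coset_mult_assoc)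
      then show ?case using a T 2 r_coset_eq_iff[OF Hs(1), of "a \<otimes>\<^bsub>G\<^esub> k" a] by simp
    qed (simp add: T)
    then show ?thesis
      using openin_continuous_map_preimage[OF continuous_map_two_sided_translation[OF tg] Hs(2)] a by simp
  qed
  then have "openin T ((\<Inter>c \<in> rcosets\<^bsub>G\<^esub> H. ?U c) \<inter> topspace T)" using fin by (rule openin_INT[rotated])
  moreover have "(\<Inter>c \<in> rcosets\<^bsub>G\<^esub> H. ?U c) \<inter> topspace T = translation_kernel G H"
    by (auto simp: T translation_kernel_def)
  ultimately show ?thesis by simp
qed

text \<open>Every finite family of such subgroups has size at most \<open>(n ^ n) ^ card X\<close>, where \<open>X\<close>
  represents the cosets of the intersection \<open>D\<close> of the given maximal subgroups: \<open>X\<close> generates the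
  group modulo the intersection \<open>N\<close> of the translation kernels of the family, since a maximal
  subgroup above \<open>N\<close> contains \<open>D\<close>. Those kernels are the source of the bound \<open>n ^ n\<close>.\<close>

lemma finite_open_subgroups_of_index:
  assumes tg: "topological_group G T" and n: "n \<ge> 1"
    and fin: "finite {M. maximal_open_subgroup M G T \<and> finite (rcosets\<^bsub>G\<^esub> M) \<and> card (rcosets\<^bsub>G\<^esub> M) \<le> n ^ n}"
  shows "finite {H. open_subgroup H G T \<and> card (rcosets\<^bsub>G\<^esub> H) = n}"
proof -
  interpret group G using tg by (simp add: topological_group_def)
  define \<M> where "\<M> = {M. maximal_open_subgroup M G T \<and> finite (rcosets\<^bsub>G\<^esub> M) \<and> card (rcosets\<^bsub>G\<^esub> M) \<le> n ^ n}"
  define D where "D = carrier G \<inter> \<Inter>\<M>"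
  have \<M>: "finite \<M>" "\<And>M. M \<in> \<M> \<Longrightarrow> subgroup M G \<and> finite (rcosets\<^bsub>G\<^esub> M)"
    using fin by (auto simp: \<M>_def maximal_open_subgroup_def open_subgroup_def)
  have D: "subgroup D G" unfolding D_def by (rule subgroup_Inter_carrier) (use \<M> in blast)
  have "rcosets\<^bsub>G\<^esub> D = (\<lambda>x. D #>\<^bsub>G\<^esub> x) ` carrier G" by (auto simp: RCOSETS_def)
  moreover have "finite (rcosets\<^bsub>G\<^esub> D)" unfolding D_def by (rule finite_index_Inter[OF \<M>])
  ultimately obtain X where X: "X \<subseteq> carrier G" "finite X" "rcosets\<^bsub>G\<^esub> D = (\<lambda>x. D #>\<^bsub>G\<^esub> x) ` X"
    using finite_subset_image[of "rcosets\<^bsub>G\<^esub> D" "\<lambda>x. D #>\<^bsub>G\<^esub> x" "carrier G"] by auto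
  \<comment> \<open>\<open>X\<close> is chosen before the finite family \<open>\<F>\<close>, which makes the bound uniform in \<open>\<F>\<close>.\<close>
  have XD: "P = carrier G" if P: "subgroup P G" "X \<subseteq> P" "D \<subseteq> P" for P
  proof (rule antisym)
    show "carrier G \<subseteq> P"
    proof
      fix g assume g: "g \<in> carrier G"
      then have "D #>\<^bsub>G\<^esub> g \<in> rcosets\<^bsub>G\<^esub> D" using rcosetsI D subgroup.subset by blast
      then obtain x where x: "x \<in> X" "D #>\<^bsub>G\<^esub> g = D #>\<^bsub>G\<^esub> x" using X(3) by auto
      then have "g \<in> D #>\<^bsub>G\<^esub> x" using rcos_self[OF g D] by simp
      then show "g \<in> P" using x P by (auto simp: r_coset_def intro: subgroup.m_closed)
    qed
  qed (use P subgroup.subset in blast)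
  have "card \<F> \<le> (n ^ n) ^ card X"
    if \<F>: "\<F> \<subseteq> {H. open_subgroup H G T \<and> card (rcosets\<^bsub>G\<^esub> H) = n}" "finite \<F>" for \<F>
  proof -
    \<comment> \<open>Infinite sets have cardinality 0, so \<open>n \<ge> 1\<close> makes the set of cosets finite.\<close>
    have F: "subgroup H G" "open_subgroup H G T" "finite (rcosets\<^bsub>G\<^esub> H)" "card (rcosets\<^bsub>G\<^esub> H) = n"
      if "H \<in> \<F>" for H
      using \<F> that n card_ge_0_finite[of "rcosets\<^bsub>G\<^esub> H"] by (auto simp: open_subgroup_def)
    let ?\<N> = "translation_kernel G ` \<F>"
    define N where "N = carrier G \<inter> \<Inter>?\<N>"
    have nN: "M \<lhd> G \<and> finite (rcosets\<^bsub>G\<^esub> M) \<and> card (rcosets\<^bsub>G\<^esub> M) \<le> n ^ n" if "M \<in> ?\<N>" for M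
      using that F index_translation_kernel_le translation_kernel_normal by fastforce
    have N: "subgroup N G" unfolding N_def
      by (rule subgroup_Inter_carrier) (use nN normal_imp_subgroup in blast)
    have Nfin: "finite (rcosets\<^bsub>G\<^esub> N)" unfolding N_def
      by (rule finite_index_Inter) (use nN normal_imp_subgroup \<F>(2) in blast)+
    have "openin T ((\<Inter>H \<in> \<F>. translation_kernel G H) \<inter> topspace T)"
      using \<F>(2) openin_translation_kernel[OF tg] F by (intro openin_INT) auto
    then have Nopen: "open_subgroup N G T"
      using N tg by (simp add: open_subgroup_def N_def topological_group_def Int_commute)
    show ?thesis
    proof (rule card_subgroups_of_index_le[where N = N])
      fix L assume L: "subgroup L G" "X \<subseteq> L" "N \<subseteq> L"
      show "L = carrier G"
      proof (rule ccontr)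
        assume "L \<noteq> carrier G"
        then obtain P where P: "subgroup P G" "L \<subseteq> P" "P \<noteq> carrier G"
          and max: "\<And>H. \<lbrakk>subgroup H G; P \<subseteq> H\<rbrakk> \<Longrightarrow> H = P \<or> H = carrier G"
          using maximal_subgroup_above[OF N Nfin L(1,3)] by metis
        have "openin T P" by (rule openin_subgroup_above[OF tg Nopen P(1)]) (use L P in blast)
        moreover have "finite (rcosets\<^bsub>G\<^esub> P) \<and> card (rcosets\<^bsub>G\<^esub> P) \<le> n ^ n"
        proof (rule index_maximal_subgroup_le[OF P(1,3) max])
          show "carrier G \<inter> \<Inter>?\<N> \<subseteq> P" using L P by (auto simp: N_def)
        qed (use \<F>(2) nN in auto)
        ultimately have "P \<in> \<M>"
          using P max by (auto simp: \<M>_def maximal_open_subgroup_def open_subgroup_def)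
        then have "D \<subseteq> P" by (auto simp: D_def)
        then show False using XD[of P] P L by blast
      qed
    next
      fix H assume "H \<in> \<F>"
      then show "subgroup H G \<and> finite (rcosets\<^bsub>G\<^esub> H) \<and> card (rcosets\<^bsub>G\<^esub> H) = n \<and> N \<subseteq> translation_kernel G H"
        using F by (auto simp: N_def)
    qed (use X in auto)
  qed
  then show ?thesis by (rule conjunct1[OF finite_if_finite_subsets_card_bdd])
qed

section \<open>Frattini covers\<close>

text \<open>A maximal open subgroup \<open>M\<close> of \<open>K\<close> contains the Frattini subgroup and with it the kernel of
  \<open>\<phi>\<close>, so it is the full preimage of its image. Hence \<open>M\<close> is determined by \<open>\<phi> ` M\<close>, and \<open>\<phi> ` M\<close> is
  open because \<open>\<phi>\<close>, being a continuous surjection from a compact to a Hausdorff space, is a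
  quotient map. The index of \<open>\<phi> ` M\<close> is at most that of \<open>M\<close>, so \<open>\<phi> ` M\<close> is one of the finitely many
  open subgroups of \<open>G\<close> of index at most \<open>r\<close>.\<close>

lemma finite_maximal_open_subgroups_cover:
  assumes small: "small_profinite_group G TG" and cover: "frattini_cover K TK G TG \<phi>"
  shows "finite {M. maximal_open_subgroup M K TK \<and> finite (rcosets\<^bsub>K\<^esub> M) \<and> card (rcosets\<^bsub>K\<^esub> M) \<le> r}"
proof -
  have tK: "topological_group K TK" "compact_space TK" and tG: "topological_group G TG" "Hausdorff_space TG"
    and epi: "\<phi> \<in> hom K G" "\<phi> ` carrier K = carrier G" and cont: "continuous_map TK TG \<phi>"
    and ker: "kernel K G \<phi> \<subseteq> frattini_subgroup K TK"
    using cover by (auto simp: frattini_cover_def profinite_group_def epi_def)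
  have top: "topspace TK = carrier K" "topspace TG = carrier G"
    using tK tG by (auto simp: topological_group_def)
  interpret K: group K using tK by (simp add: topological_group_def)
  interpret G: group G using tG by (simp add: topological_group_def)
  interpret \<phi>: group_hom K G \<phi> by unfold_locales (rule epi(1))
  define \<M> where "\<M> = {M. maximal_open_subgroup M K TK \<and> finite (rcosets\<^bsub>K\<^esub> M) \<and> card (rcosets\<^bsub>K\<^esub> M) \<le> r}"
  have sub: "subgroup M K" "openin TK M" if "M \<in> \<M>" for M
    using that by (auto simp: \<M>_def maximal_open_subgroup_def open_subgroup_def)
  have mem: "\<phi> k \<in> \<phi> ` M \<longleftrightarrow> k \<in> M" if M: "M \<in> \<M>" and k: "k \<in> carrier K" for k M
  proof
    assume "\<phi> k \<in> \<phi> ` M"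
    then obtain m where m: "m \<in> M" "\<phi> k = \<phi> m" by blast
    have mc: "m \<in> carrier K" using m(1) sub(1)[OF M] by (simp add: subgroup.mem_carrier)
    have "k \<otimes>\<^bsub>K\<^esub> inv\<^bsub>K\<^esub> m \<in> kernel K G \<phi>" using k mc m(2) by (simp add: kernel_def)
    moreover have "frattini_subgroup K TK \<subseteq> M" using M by (auto simp: frattini_subgroup_def \<M>_def)
    ultimately have "k \<otimes>\<^bsub>K\<^esub> inv\<^bsub>K\<^esub> m \<otimes>\<^bsub>K\<^esub> m \<in> M"
      using ker m(1) sub(1)[OF M] by (blast intro: subgroup.m_closed)
    then show "k \<in> M" using k mc by (simp add: K.m_assoc)
  qed blast
  have quot: "quotient_map TK TG \<phi>"
    by (rule continuous_imp_quotient_map[OF cont tK(2) tG(2)]) (simp add: top epi)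
  let ?\<G> = "\<lambda>m. {H. open_subgroup H G TG \<and> card (rcosets\<^bsub>G\<^esub> H) = m}"
  show ?thesis unfolding \<M>_def[symmetric]
  proof (rule inj_on_finite[where f = "\<lambda>M. \<phi> ` M" and B = "\<Union>m \<in> {1..r}. ?\<G> m"])
    show "inj_on (\<lambda>M. \<phi> ` M) \<M>"
    proof (rule inj_onI)
      fix M M' assume M: "M \<in> \<M>" "M' \<in> \<M>" "\<phi> ` M = \<phi> ` M'"
      have "k \<in> M \<longleftrightarrow> k \<in> M'" if "k \<in> carrier K" for k
        using mem[OF M(1) that] mem[OF M(2) that] M(3) by simp
      then show "M = M'" using subgroup.subset[OF sub(1)] M by blast
    qed
    show "(\<lambda>M. \<phi> ` M) ` \<M> \<subseteq> (\<Union>m \<in> {1..r}. ?\<G> m)"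
    proof clarify
      fix M assume M: "M \<in> \<M>"
      have s: "subgroup (\<phi> ` M) G" using \<phi>.subgroup_img_is_subgroup[OF sub(1)[OF M]] .
      have "{k \<in> topspace TK. \<phi> k \<in> \<phi> ` M} = M"
        using mem[OF M] subgroup.subset[OF sub(1)[OF M]] by (auto simp: top)
      moreover have "\<phi> ` M \<subseteq> topspace TG" using subgroup.subset[OF s] top by simp
      ultimately have o: "openin TG (\<phi> ` M)"
        using quot sub(2)[OF M] unfolding quotient_map_def by metis
      define p where "p = inv_into (carrier K) \<phi>"
      have p: "p g \<in> carrier K \<and> \<phi> (p g) = g" if "g \<in> carrier G" for g
        using inv_into_into[of g \<phi> "carrier K"] f_inv_into_f[of g \<phi> "carrier K"] that
        unfolding p_def epi(2) by simp
      have f: "(\<lambda>g. M #>\<^bsub>K\<^esub> p g) \<in> carrier G \<rightarrow> rcosets\<^bsub>K\<^esub> M"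
      proof
        fix g assume "g \<in> carrier G"
        then show "M #>\<^bsub>K\<^esub> p g \<in> rcosets\<^bsub>K\<^esub> M"
          using p K.rcosetsI[OF subgroup.subset[OF sub(1)[OF M]]] by simp
      qed
      have sep: "g \<otimes>\<^bsub>G\<^esub> inv\<^bsub>G\<^esub> h \<in> \<phi> ` M"
        if g: "g \<in> carrier G" and h: "h \<in> carrier G" and e: "M #>\<^bsub>K\<^esub> p g = M #>\<^bsub>K\<^esub> p h" for g h
      proof -
        have "p g \<otimes>\<^bsub>K\<^esub> inv\<^bsub>K\<^esub> p h \<in> M"
          using e K.r_coset_eq_iff[OF sub(1)[OF M], of "p g" "p h"] p[OF g] p[OF h] by simp
        then have "\<phi> (p g \<otimes>\<^bsub>K\<^esub> inv\<^bsub>K\<^esub> p h) \<in> \<phi> ` M" by (rule imageI)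
        then show ?thesis using p[OF g] p[OF h] by simp
      qed
      have r: "finite (rcosets\<^bsub>K\<^esub> M)" "card (rcosets\<^bsub>K\<^esub> M) \<le> r" using M by (auto simp: \<M>_def)
      note index = G.index_le_card[OF s r(1) f]
      have i1: "finite (rcosets\<^bsub>G\<^esub> (\<phi> ` M))" by (rule index(1), rule sep, assumption+)
      have i2: "card (rcosets\<^bsub>G\<^esub> (\<phi> ` M)) \<le> card (rcosets\<^bsub>K\<^esub> M)" by (rule index(2), rule sep, assumption+)
      have "\<phi> ` M \<in> rcosets\<^bsub>G\<^esub> (\<phi> ` M)" using subgroup.subgroup_in_rcosets[OF s G.is_group] .
      then have "card (rcosets\<^bsub>G\<^esub> (\<phi> ` M)) \<ge> 1"
        using i1 by (metis One_nat_def Suc_leI card_gt_0_iff empty_iff)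
      then show "\<phi> ` M \<in> (\<Union>m \<in> {1..r}. ?\<G> m)"
        using i2 r(2) s o by (auto simp: open_subgroup_def)
    qed
    show "finite (\<Union>m \<in> {1..r}. ?\<G> m)"
      using small by (auto simp: small_profinite_group_def)
  qed
qed

theorem theorem1p2:
  fixes G :: "('b, 'n) monoid_scheme" and TG :: "'b topology"
    and K :: "('a, 'm) monoid_scheme" and TK :: "'a topology"
    and \<phi> :: "'a \<Rightarrow> 'b"
  assumes "small_profinite_group G TG"
    and "frattini_cover K TK G TG \<phi>"
  shows "small_profinite_group K TK"
proof -
  have K: "profinite_group K TK" using assms(2) by (simp add: frattini_cover_def)
  then have "topological_group K TK" by (simp add: profinite_group_def)
  then have "finite {H. open_subgroup H K TK \<and> card (rcosets\<^bsub>K\<^esub> H) = n}" if "n \<ge> 1" for n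
    using that finite_maximal_open_subgroups_cover[OF assms] by (rule finite_open_subgroups_of_index)
  then show ?thesis using K by (simp add: small_profinite_group_def)
qed

end
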